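(* Let $x_1,x_2\in\mathbb{R}^2$. The family $\{x_1,x_2\}$ does weak phase retrieval in $\mathbb{R}^2$ if and only if, after normalization (that is, after multiplying each of the two vectors by a suitable nonzero real scalar), the two vectors are of the form $(1,1),(1,-1)$, or of the form $(1,b),(1,-b)$ for some real $b\neq 0$.
   Context: Two vectors $x=(a_1,\dots,a_n)$ and $y=(b_1,\dots,b_n)$ in $\mathbb{R}^n$ weakly have the same phase if there is $\theta\in\{1,-1\}$ such that $\mathrm{sgn}(a_i)=\theta\,\mathrm{sgn}(b_i)$ for every $i\in\{1,\dots,n\}$ with $a_i\neq 0\neq b_i$. A family of vectors $\{\phi_i\}_{i=1}^m$ in $\mathbb{R}^n$ does weak phase retrieval in $\mathbb{R}^n$ if whenever $x,y\in\mathbb{R}^n$ satisfy $|\langle x,\phi_i\rangle|=|\langle y,\phi_i\rangle|$ for all $i=1,\dots,m$, then $x$ and $y$ weakly have the same phase. *)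

theory Defs
  imports "HOL-Analysis.Analysis"
begin

definition weakly_same_phase :: "real ^ 'n \<Rightarrow> real ^ 'n \<Rightarrow> bool" where
  "weakly_same_phase x y \<longleftrightarrow>
     (\<exists>\<theta>\<in>{1, -1}. \<forall>i. x $ i \<noteq> 0 \<and> y $ i \<noteq> 0 \<longrightarrow> sgn (x $ i) = \<theta> * sgn (y $ i))"

(* The family consists of \<phi> 1, ..., \<phi> m; values of \<phi> at other indices play no role. *)
definition weak_phase_retrieval :: "nat \<Rightarrow> (nat \<Rightarrow> real ^ 'n) \<Rightarrow> bool" where
  "weak_phase_retrieval m \<phi> \<longleftrightarrow>
     (\<forall>x y. (\<forall>i\<in>{1..m}. \<bar>x \<bullet> \<phi> i\<bar> = \<bar>y \<bullet> \<phi> i\<bar>) \<longrightarrow> weakly_same_phase x y)"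

end

theory Submission
  imports Defs
begin

text \<open>
  In the plane, two vectors weakly have the same phase iff the product of their four coordinates
  is nonnegative. Writing the vectors as \<open>v + u\<close> and \<open>v - u\<close>, this product is
  \<open>(v\<^sub>1\<^sup>2 - u\<^sub>1\<^sup>2) (v\<^sub>2\<^sup>2 - u\<^sub>2\<^sup>2)\<close>, and equality of the measurements against \<open>\<phi>\<close> means that
  \<open>u\<close> or \<open>v\<close> is orthogonal to \<open>\<phi>\<close>. For frame vectors \<open>(p, q)\<close> and \<open>(r, s)\<close>, choosing
  \<open>u\<close> and \<open>v\<close> of equal length, orthogonal to the first and the second one respectively, turns
  the product into \<open>- (p\<^sup>2 s\<^sup>2 - q\<^sup>2 r\<^sup>2)\<^sup>2\<close>. This forces \<open>p s = \<plusminus> q r\<close>, and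
  linear independence excludes the plus sign.
\<close>

text \<open>A coordinate where either vector vanishes imposes no condition, and a single remaining
  coordinate is matched by a suitable \<open>\<theta>\<close>. A conflict needs two coordinate
  products of opposite strict signs.\<close>

lemma weakly_same_phase_2_iff:
  fixes x y :: "real ^ 2"
  shows "weakly_same_phase x y \<longleftrightarrow> 0 \<le> (x $ 1 * y $ 1) * (x $ 2 * y $ 2)"
  unfolding weakly_same_phase_def
  by (auto simp: forall_2 sgn_if zero_le_mult_iff mult_le_0_iff split: if_splits)

lemma weak_phase_retrieval_2_iff_orthogonal:
  fixes \<phi> :: "nat \<Rightarrow> real ^ 2"
  shows "weak_phase_retrieval 2 \<phi> \<longleftrightarrow>
    (\<forall>u v. (\<forall>i\<in>{1, 2}. u \<bullet> \<phi> i = 0 \<or> v \<bullet> \<phi> i = 0) \<longrightarrow>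
      0 \<le> ((v $ 1)\<^sup>2 - (u $ 1)\<^sup>2) * ((v $ 2)\<^sup>2 - (u $ 2)\<^sup>2))"
    (is "_ \<longleftrightarrow> (\<forall>u v. ?orth u v \<longrightarrow> 0 \<le> ?prod u v)")
proof -
  have idx: "{1..2} = {1, 2::nat}" by auto
  have prod: "?prod u v = ((v + u) $ 1 * (v - u) $ 1) * ((v + u) $ 2 * (v - u) $ 2)"
    for u v :: "real ^ 2"
    by (simp add: power2_eq_square algebra_simps)
  have orth: "?orth u v \<longleftrightarrow> (\<forall>i\<in>{1..2}. \<bar>(v + u) \<bullet> \<phi> i\<bar> = \<bar>(v - u) \<bullet> \<phi> i\<bar>)"
    for u v :: "real ^ 2"
    unfolding idx inner_add_left inner_diff_left by (auto simp: abs_if split: if_splits)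
  show ?thesis
  proof
    assume "weak_phase_retrieval 2 \<phi>"
    then show "\<forall>u v. ?orth u v \<longrightarrow> 0 \<le> ?prod u v"
      unfolding weak_phase_retrieval_def weakly_same_phase_2_iff orth prod by blast
  next
    assume nonneg: "\<forall>u v. ?orth u v \<longrightarrow> 0 \<le> ?prod u v"
    show "weak_phase_retrieval 2 \<phi>"
      unfolding weak_phase_retrieval_def weakly_same_phase_2_iff
    proof (intro allI impI)
      fix x y :: "real ^ 2"
      assume eq: "\<forall>i\<in>{1..2}. \<bar>x \<bullet> \<phi> i\<bar> = \<bar>y \<bullet> \<phi> i\<bar>"
      define u v where "u = (1/2) *\<^sub>R (x - y)" and "v = (1/2) *\<^sub>R (x + y)"
      have "v + u = x" "v - u = y"
        unfolding u_def v_def by (simp_all add: vec_eq_iff field_simps)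
      with nonneg eq show "0 \<le> (x $ 1 * y $ 1) * (x $ 2 * y $ 2)"
        unfolding orth prod by metis
    qed
  qed
qed

text \<open>The hypothesis is a vanishing determinant: a quarter turn of whichever vector is nonzero
  is orthogonal to both.\<close>

lemma exists_nonzero_orthogonal_pair:
  fixes a b :: "real ^ 2"
  assumes "a $ 1 * b $ 2 = a $ 2 * b $ 1"
  obtains u :: "real ^ 2" where "u \<noteq> 0" "u \<bullet> a = 0" "u \<bullet> b = 0"
proof (cases "a = 0")
  case True
  show thesis
  proof (cases "b = 0")
    case True
    with \<open>a = 0\<close> show thesis by (intro that[of "axis 1 1"]) (auto simp: axis_eq_0_iff)
  next
    case False
    with \<open>a = 0\<close> show thesis
      by (intro that[of "vector [- b $ 2, b $ 1]"])
        (auto simp: vec_eq_iff forall_2 inner_vec_def sum_2)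
  qed
next
  case False
  with assms show thesis
    by (intro that[of "vector [- a $ 2, a $ 1]"])
      (auto simp: vec_eq_iff forall_2 inner_vec_def sum_2)
qed

text \<open>This is the normal form freed of normalization: all four coordinates are nonzero and the
  slopes of the two vectors are opposite.\<close>

lemma weak_phase_retrieval_2_iff:
  fixes \<phi> :: "nat \<Rightarrow> real ^ 2"
  shows "weak_phase_retrieval 2 \<phi> \<longleftrightarrow>
    \<phi> 1 $ 1 * \<phi> 2 $ 2 = - (\<phi> 1 $ 2 * \<phi> 2 $ 1) \<and> \<phi> 1 $ 1 * \<phi> 2 $ 2 \<noteq> 0"
proof -
  define p q r s where pqrs: "p = \<phi> 1 $ 1" "q = \<phi> 1 $ 2" "r = \<phi> 2 $ 1" "s = \<phi> 2 $ 2"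
  have inner: "u \<bullet> \<phi> 1 = u $ 1 * p + u $ 2 * q" "u \<bullet> \<phi> 2 = u $ 1 * r + u $ 2 * s" for u
    by (simp_all add: inner_vec_def sum_2 pqrs)
  have "weak_phase_retrieval 2 \<phi> \<longleftrightarrow> p * s = - (q * r) \<and> p * s \<noteq> 0"
  proof
    assume wpr: "weak_phase_retrieval 2 \<phi>"
    have nonneg: "0 \<le> ((v $ 1)\<^sup>2 - (u $ 1)\<^sup>2) * ((v $ 2)\<^sup>2 - (u $ 2)\<^sup>2)"
      if "u \<bullet> \<phi> 1 = 0 \<or> v \<bullet> \<phi> 1 = 0" "u \<bullet> \<phi> 2 = 0 \<or> v \<bullet> \<phi> 2 = 0" for u v
      using wpr that unfolding weak_phase_retrieval_2_iff_orthogonal by auto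
    \<comment> \<open>Each quarter turn is scaled by the length of the other vector, so both test
      vectors have length \<open>\<alpha> * \<beta>\<close>; this makes the two factors of the
      product negatives of each other.\<close>
    define \<alpha> \<beta> where "\<alpha> = sqrt (r\<^sup>2 + s\<^sup>2)" and "\<beta> = sqrt (p\<^sup>2 + q\<^sup>2)"
    have sq: "\<alpha>\<^sup>2 = r\<^sup>2 + s\<^sup>2" "\<beta>\<^sup>2 = p\<^sup>2 + q\<^sup>2"
      by (simp_all add: \<alpha>_def \<beta>_def)
    have "0 \<le> ((\<beta> * s)\<^sup>2 - (\<alpha> * q)\<^sup>2) * ((\<beta> * r)\<^sup>2 - (\<alpha> * p)\<^sup>2)"
      using nonneg[of "vector [- \<alpha> * q, \<alpha> * p]" "vector [- \<beta> * s, \<beta> * r]"]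
      by (simp add: inner del: One_nat_def)
    also have "\<dots> = - ((p * s)\<^sup>2 - (q * r)\<^sup>2)\<^sup>2"
      unfolding power_mult_distrib sq by algebra
    finally have "(p * s)\<^sup>2 = (q * r)\<^sup>2" by simp
    moreover have "p * s \<noteq> q * r"
    proof
      assume "p * s = q * r"
      then obtain u where "u \<noteq> 0" and u: "u \<bullet> \<phi> 1 = 0" "u \<bullet> \<phi> 2 = 0"
        using exists_nonzero_orthogonal_pair[of "\<phi> 1" "\<phi> 2"] unfolding pqrs by blast
      \<comment> \<open>As \<open>u\<close> is orthogonal to both vectors, \<open>v\<close> is
        arbitrary. With one coordinate of \<open>v\<close> zero and the other larger in modulus than
        that of \<open>u\<close>, the product is nonnegative only if the former coordinate of
        \<open>u\<close> vanishes.\<close>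
      have lt: "0 < (\<bar>t\<bar> + 1)\<^sup>2 - t\<^sup>2" for t :: real
        by (simp add: power2_sum)
      have "u $ 1 = 0"
        using nonneg[of u "vector [0, \<bar>u $ 2\<bar> + 1]"] u lt[of "u $ 2"]
        by (auto simp: mult_le_0_iff)
      moreover have "u $ 2 = 0"
        using nonneg[of u "vector [\<bar>u $ 1\<bar> + 1, 0]"] u lt[of "u $ 1"]
        by (auto simp: zero_le_mult_iff mult_le_0_iff)
      ultimately show False using \<open>u \<noteq> 0\<close> by (simp add: vec_eq_iff forall_2)
    qed
    \<comment> \<open>If \<open>p * s\<close> were zero, equality of the squares would give
      \<open>q * r = 0 = p * s\<close>.\<close>
    ultimately show "p * s = - (q * r) \<and> p * s \<noteq> 0" by (auto simp: power2_eq_iff)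
  next
    assume "p * s = - (q * r) \<and> p * s \<noteq> 0"
    then have ps: "p * s = - (q * r)" and nz: "p \<noteq> 0" "q \<noteq> 0" "r \<noteq> 0" "s \<noteq> 0" by auto
    define k where "k = q / p"
    have q: "q = k * p" and s: "s = - k * r" and "k \<noteq> 0"
      using ps nz by (auto simp: k_def field_simps)
    have orth: "u \<bullet> \<phi> 1 = 0 \<longleftrightarrow> u $ 1 = - k * u $ 2" "u \<bullet> \<phi> 2 = 0 \<longleftrightarrow> u $ 1 = k * u $ 2" for u
    proof -
      have "u \<bullet> \<phi> 1 = p * (u $ 1 + k * u $ 2)" "u \<bullet> \<phi> 2 = r * (u $ 1 - k * u $ 2)"
        unfolding inner q s by (simp_all add: algebra_simps)
      then show "u \<bullet> \<phi> 1 = 0 \<longleftrightarrow> u $ 1 = - k * u $ 2" "u \<bullet> \<phi> 2 = 0 \<longleftrightarrow> u $ 1 = k * u $ 2"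
        using nz by auto
    qed
    \<comment> \<open>This settles the case where \<open>u\<close> and \<open>v\<close> are
      orthogonal to different frame vectors; a vector orthogonal to both is zero because
      \<open>k \<noteq> 0\<close>.\<close>
    have cross: "0 \<le> ((k * b)\<^sup>2 - (k * a)\<^sup>2) * (b\<^sup>2 - a\<^sup>2)" for a b
    proof -
      have "((k * b)\<^sup>2 - (k * a)\<^sup>2) * (b\<^sup>2 - a\<^sup>2) = (k * (b\<^sup>2 - a\<^sup>2))\<^sup>2" by algebra
      then show ?thesis by simp
    qed
    show "weak_phase_retrieval 2 \<phi>"
      unfolding weak_phase_retrieval_2_iff_orthogonal
    proof (intro allI impI)
      fix u v :: "real ^ 2"
      assume "\<forall>i\<in>{1, 2}. u \<bullet> \<phi> i = 0 \<or> v \<bullet> \<phi> i = 0"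
      then show "0 \<le> ((v $ 1)\<^sup>2 - (u $ 1)\<^sup>2) * ((v $ 2)\<^sup>2 - (u $ 2)\<^sup>2)"
        using \<open>k \<noteq> 0\<close> cross[of "v $ 2" "u $ 2"] by (auto simp: orth simp del: One_nat_def)
    qed
  qed
  then show ?thesis unfolding pqrs .
qed

theorem theorem4:
  fixes x :: "nat \<Rightarrow> real ^ 2"
  shows "weak_phase_retrieval 2 x \<longleftrightarrow>
    (\<exists>c\<^sub>1 c\<^sub>2 :: real. c\<^sub>1 \<noteq> 0 \<and> c\<^sub>2 \<noteq> 0 \<and>
      ({c\<^sub>1 *\<^sub>R x 1, c\<^sub>2 *\<^sub>R x 2} = {vector [1, 1], vector [1, -1]} \<or>
       (\<exists>b :: real. b \<noteq> 0 \<and>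
          {c\<^sub>1 *\<^sub>R x 1, c\<^sub>2 *\<^sub>R x 2} = {vector [1, b], vector [1, -b]})))"
proof
  assume "weak_phase_retrieval 2 x"
  then have eq: "x 1 $ 1 * x 2 $ 2 = - (x 1 $ 2 * x 2 $ 1)"
    and nz: "x 1 $ 1 \<noteq> 0" "x 1 $ 2 \<noteq> 0" "x 2 $ 1 \<noteq> 0" "x 2 $ 2 \<noteq> 0"
    unfolding weak_phase_retrieval_2_iff by auto
  define b where "b = x 1 $ 2 / x 1 $ 1"
  have "(1 / x 1 $ 1) *\<^sub>R x 1 = vector [1, b]" "(1 / x 2 $ 1) *\<^sub>R x 2 = vector [1, - b]"
    using eq nz by (auto simp: b_def vec_eq_iff forall_2 field_simps)
  moreover have "b \<noteq> 0" "1 / x 1 $ 1 \<noteq> 0" "1 / x 2 $ 1 \<noteq> 0"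
    using nz by (simp_all add: b_def)
  ultimately show "\<exists>c\<^sub>1 c\<^sub>2 :: real. c\<^sub>1 \<noteq> 0 \<and> c\<^sub>2 \<noteq> 0 \<and>
      ({c\<^sub>1 *\<^sub>R x 1, c\<^sub>2 *\<^sub>R x 2} = {vector [1, 1], vector [1, -1]} \<or>
       (\<exists>b :: real. b \<noteq> 0 \<and>
          {c\<^sub>1 *\<^sub>R x 1, c\<^sub>2 *\<^sub>R x 2} = {vector [1, b], vector [1, -b]}))"
    by metis
next
  assume "\<exists>c\<^sub>1 c\<^sub>2 :: real. c\<^sub>1 \<noteq> 0 \<and> c\<^sub>2 \<noteq> 0 \<and>
      ({c\<^sub>1 *\<^sub>R x 1, c\<^sub>2 *\<^sub>R x 2} = {vector [1, 1], vector [1, -1]} \<or>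
       (\<exists>b :: real. b \<noteq> 0 \<and>
          {c\<^sub>1 *\<^sub>R x 1, c\<^sub>2 *\<^sub>R x 2} = {vector [1, b], vector [1, -b]}))"
  \<comment> \<open>The first form is the case \<open>b = 1\<close> of the second.\<close>
  then obtain c d b :: real where "c \<noteq> 0" "d \<noteq> 0" "b \<noteq> 0"
    and "{c *\<^sub>R x 1, d *\<^sub>R x 2} = {vector [1, b], vector [1, -b]}"
    by (metis zero_neq_one)
  \<comment> \<open>The sets are unordered; swapping their elements amounts to replacing
    \<open>b\<close> by \<open>- b\<close>.\<close>
  then obtain b' where "b' \<noteq> 0"
    and "c *\<^sub>R x 1 = vector [1, b']" "d *\<^sub>R x 2 = vector [1, - b']"
    unfolding doubleton_eq_iff by (metis minus_minus neg_equal_0_iff_equal)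
  then have "c * x 1 $ 1 = 1" "c * x 1 $ 2 = b'" "d * x 2 $ 1 = 1" "d * x 2 $ 2 = - b'"
    by (simp_all add: vec_eq_iff forall_2)
  then have "x 1 $ 1 = 1 / c" "x 1 $ 2 = b' / c" "x 2 $ 1 = 1 / d" "x 2 $ 2 = - b' / d"
    using \<open>c \<noteq> 0\<close> \<open>d \<noteq> 0\<close> by (simp_all add: field_simps)
  then show "weak_phase_retrieval 2 x"
    unfolding weak_phase_retrieval_2_iff using \<open>b' \<noteq> 0\<close> \<open>c \<noteq> 0\<close> \<open>d \<noteq> 0\<close> by simp
qed

end
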